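(* Let $\gamma_{LG},\gamma_{SL},\gamma_{SG},\rho,g,\xi,\zeta,V>0$ be constants with $\cos\theta_Y=\frac{\gamma_{SG}-\gamma_{SL}}{\gamma_{LG}}\in(0,1)$. For $\eta(t)=(\Gamma(t),u(t))\in\mathcal M$, $t\in[0,T]$, with wetting domain $D(t)$, $\partial D(t)=\Gamma(t)$, with contact line speed $v_{CL}$ and with a Lagrange multiplier $\lambda(t)\in\mathbb R$, let $F,F_Y,B_\eta,T_\eta\mathcal M,Y_\eta$ and $K$ be as in the context. Consider the following two parabolic variational inequalities (required at every $t\in[0,T]$). (PVI-1) $\eta(t)\in\mathcal M$, $(v_{CL},\partial_t u)\in T_\eta\mathcal M$, $\ \xi v_{CL}=F_Y$ on $\Gamma(t)$, $\ \int_{D(t)}u\,dx\,dy=V$, and $$\zeta\int_{D(t)}\frac{\partial_t u}{\sqrt{1+|\nabla u|^2}}(\tilde v-\partial_t u)\,dx\,dy\ \ge\ \int_{D(t)}F\,(\tilde v-\partial_t u)\,dx\,dy\qquad\forall\,\tilde v\in Y_\eta .$$ (PVI-2) $\eta(t)\in\mathcal M$, $(v_{CL},\partial_t u)\in T_\eta\mathcal M$, $\ \xi v_{CL}=F_Y$ on $\Gamma(t)$, $\ \int_{D(t)}u\,dx\,dy=V$, and $$\zeta\int_{D(t)}\frac{\partial_t u}{\sqrt{1+|\nabla u|^2}}(\tilde v-u)\,dx\,dy\ \ge\ \int_{D(t)}F\,(\tilde v-u)\,dx\,dy\qquad\forall\,\tilde v\in K .$$ (i) Let $(\Gamma(t),u(t))$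 be a smooth solution of (PVI-1). Then $(\Gamma(t),u(t))\in\mathcal M$ satisfies the following strong form: $(v_{CL},\partial_t u)\in T_\eta\mathcal M$; $\ \xi v_{CL}=F_Y$ on $\Gamma(t)$; in $D(t)$, $$\begin{cases}\zeta\,\dfrac{\partial_t u}{\sqrt{1+|\nabla u|^2}}=F & \text{at points } (x,y) \text{ with } (x,y)\notin B_\eta \text{ or } F\ge 0,\\[2mm] \partial_t u=0 & \text{at points } (x,y)\in B_\eta \text{ with } F<0;\end{cases}$$ and $\int_{D(t)}u\,dx\,dy=V$. (ii) Let $(\Gamma(t),u(t))$ be a smooth solution of (PVI-2). Then $(\Gamma(t),u(t))\in\mathcal M$ satisfies the same strong form.
   Context: A droplet sits on the plane $z=0$. Its wetting domain is a planar domain $D\subset\mathbb R^2$ with boundary $\Gamma=\partial D$ (the contact line), and its capillary surface is the graph of $u:D\to\mathbb R$. Configuration manifold: $\mathcal M=\{(\Gamma,u):\ \Gamma\in C^1,\ u\in C^2(D)\cap L^2(D),\ u\ge0\text{ on }D,\ u|_\Gamma=0\}$. For $\eta=(\Gamma,u)\in\mathcal M$: - Coincidence set: $B_\eta=\{(x,y)\in D:\ u(x,y)=0\}$. - Outer normal at the contact line: $n_{CL}=-\nabla u/|\nabla u|$ on $\Gamma$. The contact line speed $v_{CL}$ is the speed of $\Gamma(t)$ in direction $n_{CL}$. - Contact angle $\theta_{CL}$ at $\Gamma$: $\tan\theta_{CL}=|\nabla u|$, so $\cos\theta_{CL}=1/\sqrt{1+|\nabla u|^2}$. - Admissible tangent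 cone: $T_\eta\mathcal M$ is the set of pairs $(v_{CL},v)$ of $C^1$ functions, $v_{CL}$ on $\Gamma$ and $v$ on $D$ (up to $\Gamma$), with $v=|\nabla u|\,v_{CL}$ on $\Gamma$ and $v\ge0$ on $B_\eta$. - $Y_\eta=\{v\in L^2(D):\ v\ge0\text{ on }B_\eta\}$ and $K=\{v\in C^1_c(D):\ v\ge0\}$. - Forces: $F=-\rho g u+\gamma_{LG}\nabla\cdot\Big(\frac{\nabla u}{\sqrt{1+|\nabla u|^2}}\Big)+\lambda(t)$ in $D$, where $\lambda(t)\in\mathbb R$ is the Lagrange multiplier of the volume constraint, part of the unknowns; and $F_Y=\gamma_{LG}(\cos\theta_Y-\cos\theta_{CL})$ on $\Gamma$. "Smooth solution" means that $\Gamma$ and $u$ are regular enough in space and time (up to the boundary and up to the end times) that all derivatives appearing exist classically and are continuous. *)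

theory Defs
  imports "HOL-Analysis.Analysis"
begin

type_synonym plane = "real ^ 2"

text \<open>
  All derivatives are taken within the set \<open>S\<close> on which the function lives. For
  \<open>x\<close> in the interior of \<open>S\<close> this is the ordinary derivative; for \<open>S\<close> the closure of a domain
  with \<open>C\<^sup>1\<close> boundary it is the (still uniquely determined) one-sided derivative up to the
  boundary. Values of functions outside \<open>S\<close> play no role.
\<close>

definition grad :: "'a::euclidean_space set \<Rightarrow> ('a \<Rightarrow> real) \<Rightarrow> 'a \<Rightarrow> 'a" where
  "grad S f x = (\<Sum>b\<in>Basis. frechet_derivative f (at x within S) b *\<^sub>R b)"

definition divergence :: "'a::euclidean_space set \<Rightarrow> ('a \<Rightarrow> 'a) \<Rightarrow> 'a \<Rightarrow> real" where
  "divergence S W x = (\<Sum>b\<in>Basis. frechet_derivative W (at x within S) b \<bullet> b)"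

definition C1_on :: "'a::euclidean_space set \<Rightarrow> ('a \<Rightarrow> real) \<Rightarrow> bool" where
  "C1_on S f \<longleftrightarrow> (\<forall>x\<in>S. f differentiable (at x within S)) \<and> continuous_on S (grad S f)"

definition C2_on :: "'a::euclidean_space set \<Rightarrow> ('a \<Rightarrow> real) \<Rightarrow> bool" where
  "C2_on S f \<longleftrightarrow> C1_on S f \<and> (\<forall>b\<in>Basis. C1_on S (\<lambda>x. grad S f x \<bullet> b))"

text \<open>
  On a curve \<open>\<Gamma>\<close> the derivative within \<open>\<Gamma>\<close> does not determine a gradient, so a \<open>C\<^sup>1\<close> function
  on \<open>\<Gamma>\<close> is one that is the restriction of a \<open>C\<^sup>1\<close> function on a neighbourhood.
\<close>

definition C1_on_curve :: "plane set \<Rightarrow> (plane \<Rightarrow> real) \<Rightarrow> bool" where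
  "C1_on_curve \<Gamma> f \<longleftrightarrow>
     (\<exists>U h. open U \<and> \<Gamma> \<subseteq> U \<and> C1_on U h \<and> (\<forall>x\<in>\<Gamma>. h x = f x))"

definition L2_on :: "plane set \<Rightarrow> (plane \<Rightarrow> real) \<Rightarrow> bool" where
  "L2_on D f \<longleftrightarrow> f \<in> borel_measurable (lebesgue_on D) \<and> integrable (lebesgue_on D) (\<lambda>x. (f x)\<^sup>2)"

text \<open>
  The contact line is a \<open>C\<^sup>1\<close> curve: near each of its points it is a regular level curve of
  a \<open>C\<^sup>1\<close> function, with the domain on one side. It may have several components.
\<close>

definition C1_boundary :: "plane set \<Rightarrow> bool" where
  "C1_boundary D \<longleftrightarrow>
     (\<forall>p\<in>frontier D. \<exists>U \<phi>. open U \<and> p \<in> U \<and> C1_on U \<phi> \<and>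
        (\<forall>x\<in>U. grad U \<phi> x \<noteq> 0) \<and> D \<inter> U = {x\<in>U. \<phi> x < 0})"

text \<open>
  A configuration \<open>(\<Gamma>, u)\<close> is represented by \<open>(D, u)\<close> with \<open>\<Gamma> = frontier D\<close>; the wetting
  domain of a droplet is bounded.
\<close>

definition config_manifold :: "(plane set \<times> (plane \<Rightarrow> real)) set" where
  "config_manifold = {(D, u).
     open D \<and> connected D \<and> bounded D \<and> C1_boundary D \<and>
     C2_on D u \<and> L2_on D u \<and> (\<forall>x\<in>D. u x \<ge> 0) \<and> (\<forall>x\<in>frontier D. u x = 0)}"

definition coincidence_set :: "plane set \<Rightarrow> (plane \<Rightarrow> real) \<Rightarrow> plane set" where
  "coincidence_set D u = {x\<in>D. u x = 0}"

text \<open>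
  Where \<open>\<nabla>u = 0\<close> on the contact line the normal is not defined; the formula then yields \<open>0\<close>.
  This case cannot occur in a solution: it would give contact line speed \<open>0\<close>, but
  \<open>F\<^sub>Y = \<gamma>\<^sub>L\<^sub>G (cos \<theta>\<^sub>Y - 1) < 0\<close>.
\<close>

definition contact_normal :: "plane set \<Rightarrow> (plane \<Rightarrow> real) \<Rightarrow> plane \<Rightarrow> plane" where
  "contact_normal D u x =
     - (grad (closure D) u x /\<^sub>R norm (grad (closure D) u x))"

definition contact_angle :: "plane set \<Rightarrow> (plane \<Rightarrow> real) \<Rightarrow> plane \<Rightarrow> real" where
  "contact_angle D u x = arctan (norm (grad (closure D) u x))"

definition tangent_cone ::
    "plane set \<Rightarrow> (plane \<Rightarrow> real) \<Rightarrow> ((plane \<Rightarrow> real) \<times> (plane \<Rightarrow> real)) set" where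
  "tangent_cone D u = {(vCL, v).
     C1_on_curve (frontier D) vCL \<and> C1_on (closure D) v \<and>
     (\<forall>x\<in>frontier D. v x = norm (grad (closure D) u x) * vCL x) \<and>
     (\<forall>x\<in>coincidence_set D u. v x \<ge> 0)}"

definition Y_set :: "plane set \<Rightarrow> (plane \<Rightarrow> real) \<Rightarrow> (plane \<Rightarrow> real) set" where
  "Y_set D u = {v. L2_on D v \<and> (AE x in lebesgue_on D. x \<in> coincidence_set D u \<longrightarrow> v x \<ge> 0)}"

definition K_set :: "plane set \<Rightarrow> (plane \<Rightarrow> real) set" where
  "K_set D = {v. C1_on D v \<and>
     compact (closure {x\<in>D. v x \<noteq> 0}) \<and> closure {x\<in>D. v x \<noteq> 0} \<subseteq> D \<and>
     (\<forall>x\<in>D. v x \<ge> 0)}"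

definition area_factor :: "plane set \<Rightarrow> (plane \<Rightarrow> real) \<Rightarrow> plane \<Rightarrow> real" where
  "area_factor D u x = sqrt (1 + (norm (grad (closure D) u x))\<^sup>2)"

definition bulk_force ::
    "real \<Rightarrow> real \<Rightarrow> real \<Rightarrow> real \<Rightarrow> plane set \<Rightarrow> (plane \<Rightarrow> real) \<Rightarrow> plane \<Rightarrow> real" where
  "bulk_force \<rho> g \<gamma>LG lam D u x =
     - \<rho> * g * u x
     + \<gamma>LG * divergence (closure D) (\<lambda>y. grad (closure D) u y /\<^sub>R area_factor D u y) x
     + lam"

definition young_force ::
    "real \<Rightarrow> real \<Rightarrow> plane set \<Rightarrow> (plane \<Rightarrow> real) \<Rightarrow> plane \<Rightarrow> real" where
  "young_force \<gamma>LG \<theta>Y D u x = \<gamma>LG * (cos \<theta>Y - cos (contact_angle D u x))"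

definition spacetime :: "real \<Rightarrow> (real \<Rightarrow> plane set) \<Rightarrow> (real \<times> plane) set" where
  "spacetime T D = (SIGMA t:{0..T}. closure (D t))"

text \<open>
  A point of \<open>\<Gamma>(t)\<close> need not lie in the closure of \<open>D(s)\<close> for any \<open>s \<noteq> t\<close>, so \<open>\<partial>\<^sub>t u\<close> is taken
  as the time component of the space-time derivative; for \<open>x\<close> in \<open>D(t)\<close> this is the usual
  (at \<open>t = 0, T\<close> one-sided) derivative of \<open>s \<mapsto> u(s, x)\<close>.
\<close>

definition time_deriv ::
    "real \<Rightarrow> (real \<Rightarrow> plane set) \<Rightarrow> (real \<Rightarrow> plane \<Rightarrow> real) \<Rightarrow> real \<Rightarrow> plane \<Rightarrow> real" where
  "time_deriv T D u t x = fst (grad (spacetime T D) (\<lambda>(s, y). u s y) (t, x))"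

text \<open>
  The contact line speed at \<open>x \<in> \<Gamma>(t)\<close> is the component along \<open>n\<^sub>C\<^sub>L\<close> of the velocity of a point
  travelling on the moving contact line (it does not depend on the chosen trajectory).
\<close>

definition contact_line_speed ::
    "real \<Rightarrow> (real \<Rightarrow> plane set) \<Rightarrow> (real \<Rightarrow> plane \<Rightarrow> real) \<Rightarrow> (real \<Rightarrow> plane \<Rightarrow> real) \<Rightarrow> bool" where
  "contact_line_speed T D u vCL \<longleftrightarrow>
     (\<forall>t\<in>{0..T}. \<forall>x\<in>frontier (D t). \<exists>p w.
        p t = x \<and> (\<forall>\<^sub>F s in at t within {0..T}. p s \<in> frontier (D s)) \<and>
        (p has_vector_derivative w) (at t within {0..T}) \<and>
        vCL t x = w \<bullet> contact_normal (D t) (u t) x)"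

text \<open>
  The moving contact line is of class \<open>C\<^sup>1\<close> in space and time: it has a \<open>C\<^sup>1\<close> level set
  function. The surface has continuous \<open>\<partial>\<^sub>t u\<close>, \<open>\<nabla>u\<close>, \<open>\<nabla>\<^sup>2 u\<close> up to the contact line and the
  end times. No regularity of the Lagrange multiplier is required.
\<close>

definition smooth_contact_line :: "real \<Rightarrow> (real \<Rightarrow> plane set) \<Rightarrow> bool" where
  "smooth_contact_line T D \<longleftrightarrow>
     (\<exists>\<phi>. C1_on ({0..T} \<times> UNIV) (\<lambda>(t, x). \<phi> t x) \<and>
        (\<forall>t\<in>{0..T}. D t = {x. \<phi> t x < 0} \<and> (\<forall>x\<in>frontier (D t). grad UNIV (\<phi> t) x \<noteq> 0)))"

definition smooth_evolution ::
    "real \<Rightarrow> (real \<Rightarrow> plane set) \<Rightarrow> (real \<Rightarrow> plane \<Rightarrow> real) \<Rightarrow> bool" where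
  "smooth_evolution T D u \<longleftrightarrow>
     smooth_contact_line T D \<and>
     C1_on (spacetime T D) (\<lambda>(t, x). u t x) \<and>
     (\<forall>t\<in>{0..T}. \<forall>x\<in>closure (D t).
        grad (closure (D t)) (u t) differentiable (at x within closure (D t))) \<and>
     (\<forall>b\<in>Basis. continuous_on (spacetime T D)
        (\<lambda>(t, x). frechet_derivative (grad (closure (D t)) (u t)) (at x within closure (D t)) b))"

definition common_conditions where
  "common_conditions \<gamma>LG \<theta>Y \<xi> V T D u vCL \<longleftrightarrow>
     (\<forall>t\<in>{0..T::real}.
        (D t, u t) \<in> config_manifold \<and>
        (vCL t, time_deriv T D u t) \<in> tangent_cone (D t) (u t) \<and>
        (\<forall>x\<in>frontier (D t). \<xi> * vCL t x = young_force \<gamma>LG \<theta>Y (D t) (u t) x) \<and>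
        (LINT x|lebesgue_on (D t). u t x) = V)"

definition PVI1 where
  "PVI1 \<gamma>LG \<theta>Y \<rho> g \<xi> \<zeta> V T D u vCL lam \<longleftrightarrow>
     common_conditions \<gamma>LG \<theta>Y \<xi> V T D u vCL \<and>
     (\<forall>t\<in>{0..T}. \<forall>w\<in>Y_set (D t) (u t).
        \<zeta> * (LINT x|lebesgue_on (D t).
              time_deriv T D u t x / area_factor (D t) (u t) x * (w x - time_deriv T D u t x))
        \<ge> (LINT x|lebesgue_on (D t).
              bulk_force \<rho> g \<gamma>LG (lam t) (D t) (u t) x * (w x - time_deriv T D u t x)))"

definition PVI2 where
  "PVI2 \<gamma>LG \<theta>Y \<rho> g \<xi> \<zeta> V T D u vCL lam \<longleftrightarrow>
     common_conditions \<gamma>LG \<theta>Y \<xi> V T D u vCL \<and>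
     (\<forall>t\<in>{0..T}. \<forall>w\<in>K_set (D t).
        \<zeta> * (LINT x|lebesgue_on (D t).
              time_deriv T D u t x / area_factor (D t) (u t) x * (w x - u t x))
        \<ge> (LINT x|lebesgue_on (D t).
              bulk_force \<rho> g \<gamma>LG (lam t) (D t) (u t) x * (w x - u t x)))"

definition strong_form where
  "strong_form \<gamma>LG \<theta>Y \<rho> g \<xi> \<zeta> V T D u vCL lam \<longleftrightarrow>
     common_conditions \<gamma>LG \<theta>Y \<xi> V T D u vCL \<and>
     (\<forall>t\<in>{0..T}. \<forall>x\<in>D t.
        let F = bulk_force \<rho> g \<gamma>LG (lam t) (D t) (u t) x; B = coincidence_set (D t) (u t) in
        (x \<notin> B \<or> F \<ge> 0 \<longrightarrow> \<zeta> * (time_deriv T D u t x / area_factor (D t) (u t) x) = F) \<and>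
        (x \<in> B \<and> F < 0 \<longrightarrow> time_deriv T D u t x = 0))"

end

(*
  Let G = zeta u_t / sqrt(1 + |grad u|^2) - F. Testing the inequality with bump functions
  gives G >= 0 in D, and G = 0 wherever the test direction can also be reversed: for PVI-1
  where u > 0 or u_t > 0, for PVI-2 (through the test function 0, which gives G u = 0) where
  u > 0. The strong form follows from G >= 0, from G = 0 where u > 0 or u_t > 0, and from
  u_t >= 0 on the coincidence set. For PVI-2 a point with u = 0 and u_t > 0 is approached in
  time: there u > 0, hence G = 0, at all nearby times, and G is continuous up to the multiplier.
*)
theory Submission
  imports Defs
begin

section \<open>Compactly supported test functions\<close>

text \<open>Squaring the positive part makes the cutoff C^1 across the sphere of radius
  \<open>r\<close>, which is the regularity that \<open>K_set\<close> demands.\<close>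

definition bump :: "'a::real_inner \<Rightarrow> real \<Rightarrow> 'a \<Rightarrow> real" where
  "bump a r x = (max 0 (r\<^sup>2 - (x - a) \<bullet> (x - a)))\<^sup>2"

lemma bump_nonneg: "0 \<le> bump a r x"
  by (simp add: bump_def)

lemma bump_center: "0 < r \<Longrightarrow> 0 < bump a r a"
  by (simp add: bump_def)

lemma bump_eq_0: "x \<notin> ball a r \<Longrightarrow> 0 < r \<Longrightarrow> bump a r x = 0"
  by (auto simp: bump_def dot_square_norm dist_norm norm_minus_commute max_def not_less
      intro!: antisym power_mono)

lemma bump_le: "0 \<le> r \<Longrightarrow> bump a r x \<le> r ^ 4"
proof -
  have "(max 0 (r\<^sup>2 - (x - a) \<bullet> (x - a)))\<^sup>2 \<le> (r\<^sup>2)\<^sup>2"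
    by (intro power_mono) auto
  then show ?thesis
    by (simp add: bump_def flip: power_mult)
qed

lemma continuous_on_bump [continuous_intros]: "continuous_on S (bump a r)"
  unfolding bump_def by (intro continuous_intros)

text \<open>The two branches meet at the kink with common slope 0: there the difference quotient is
  at most \<open>\<bar>h\<bar>\<close> in absolute value.\<close>

lemma has_real_derivative_max_0_power2:
  "((\<lambda>s::real. (max 0 s)\<^sup>2) has_real_derivative 2 * max 0 s) (at s)"
proof (cases s "0::real" rule: linorder_cases)
  case less
  have "((\<lambda>s::real. 0) has_real_derivative 2 * max 0 s) (at s)"
    using less by (auto intro!: derivative_eq_intros)
  then show ?thesis
    by (rule has_field_derivative_transform_within_open[where S="{..<0}"]) (use less in auto)
next
  case greater
  have "((\<lambda>s::real. s\<^sup>2) has_real_derivative 2 * max 0 s) (at s)"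
    using greater by (auto intro!: derivative_eq_intros)
  then show ?thesis
    by (rule has_field_derivative_transform_within_open[where S="{0<..}"]) (use greater in auto)
next
  case equal
  have "((\<lambda>h::real. (max 0 h)\<^sup>2 / h) \<longlongrightarrow> 0) (at 0)"
  proof (rule Lim_null_comparison)
    show "\<forall>\<^sub>F h in at 0. norm ((max 0 h)\<^sup>2 / h) \<le> \<bar>h\<bar>"
      by (intro always_eventually) (auto simp: max_def power2_eq_square)
    show "((\<lambda>h::real. \<bar>h\<bar>) \<longlongrightarrow> 0) (at 0)"
      by (intro tendsto_rabs_zero tendsto_ident_at)
  qed
  then show ?thesis
    using equal by (simp add: DERIV_def)
qed

lemma has_derivative_bump:
  "(bump a r has_derivative (\<lambda>h. ((- 4 * max 0 (r\<^sup>2 - (x - a) \<bullet> (x - a))) *\<^sub>R (x - a)) \<bullet> h)) (at x)"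
proof -
  have "((\<lambda>x. r\<^sup>2 - (x - a) \<bullet> (x - a)) has_derivative (\<lambda>h. - 2 * ((x - a) \<bullet> h))) (at x)"
    by (rule has_derivative_eq_rhs, (rule derivative_intros)+) (simp add: fun_eq_iff inner_commute)
  from has_derivative_compose[OF this
      has_real_derivative_max_0_power2[unfolded has_field_derivative_def]]
  show ?thesis
    unfolding bump_def by (rule has_derivative_eq_rhs) (auto simp: fun_eq_iff)
qed

lemma grad_eqI:
  assumes "(f has_derivative (\<lambda>h. g \<bullet> h)) (at x)" "x \<in> interior S"
  shows "grad S f x = g"
proof -
  have "frechet_derivative f (at x within S) = (\<lambda>h. g \<bullet> h)"
    using frechet_derivative_at[OF assms(1)] at_within_interior[OF assms(2)] by simp
  then show ?thesis
    by (simp add: grad_def euclidean_representation)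
qed

lemma C1_on_of_gradient:
  assumes "open D" "continuous_on D g" "\<And>x. x \<in> D \<Longrightarrow> (f has_derivative (\<lambda>h. g x \<bullet> h)) (at x)"
  shows "C1_on D f"
  unfolding C1_on_def
proof (intro conjI ballI)
  fix x assume "x \<in> D"
  from assms(3)[OF this] show "f differentiable (at x within D)"
    using has_derivative_at_withinI differentiable_def by blast
next
  have "g x = grad D f x" if "x \<in> D" for x
    using grad_eqI[OF assms(3)[OF that]] that assms(1) by (simp add: interior_open)
  then show "continuous_on D (grad D f)"
    by (rule continuous_on_eq[OF assms(2)])
qed

text \<open>The closed ball inside \<open>D\<close> contains the support and so makes it compact.
  The factor \<open>c\<close> supplies arbitrarily large test functions, and the zero function for
  \<open>c = 0\<close>.\<close>

lemma bump_in_K_set: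
  assumes "open D" "0 < r" "cball a r \<subseteq> D" "0 \<le> c"
  shows "(\<lambda>x. c * bump a r x) \<in> K_set D"
proof -
  let ?S = "{x \<in> D. c * bump a r x \<noteq> 0}"
  have "?S \<subseteq> cball a r"
  proof
    fix x assume "x \<in> ?S"
    then have "x \<in> ball a r"
      using bump_eq_0[of x a r] assms(2) by (cases "x \<in> ball a r") simp_all
    then show "x \<in> cball a r"
      by simp
  qed
  then have *: "closure ?S \<subseteq> cball a r"
    by (rule closure_minimal) simp
  have "compact (cball a r \<inter> closure ?S)"
    by (intro compact_Int_closed compact_cball closed_closure)
  then have "compact (closure ?S)"
    using * by (simp only: Int_absorb1)
  moreover have "C1_on D (\<lambda>x. c * bump a r x)"
  proof (rule C1_on_of_gradient[OF assms(1)])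
    let ?g = "\<lambda>x. c *\<^sub>R ((- 4 * max 0 (r\<^sup>2 - (x - a) \<bullet> (x - a))) *\<^sub>R (x - a))"
    show "continuous_on D ?g"
      by (intro continuous_intros)
    show "((\<lambda>x. c * bump a r x) has_derivative (\<lambda>h. ?g x \<bullet> h)) (at x)" for x
      using has_derivative_mult_right[OF has_derivative_bump[of a r x], of c]
      by (simp only: inner_scaleR_left)
  qed
  moreover have "closure ?S \<subseteq> D"
    using * assms(3) by (rule subset_trans)
  moreover have "\<forall>x\<in>D. 0 \<le> c * bump a r x"
    using assms(4) bump_nonneg by (intro ballI mult_nonneg_nonneg)
  ultimately show ?thesis
    unfolding K_set_def by blast
qed

section \<open>Integrals of continuous functions over the domain\<close>

text \<open>The closure of \<open>D\<close> is compact, so \<open>f\<close> is Borel integrable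
  there; integrability then passes to the completed measure and to the subset
  \<open>D\<close>.\<close>

lemma integrable_lebesgue_on_of_continuous_closure:
  fixes f :: "'a::euclidean_space \<Rightarrow> real"
  assumes "open D" "bounded D" "continuous_on (closure D) f"
  shows "integrable (lebesgue_on D) f"
proof -
  have "integrable lborel (\<lambda>x. indicator (closure D) x *\<^sub>R f x)"
    using assms by (intro borel_integrable_compact) (auto simp: compact_closure)
  then have "set_integrable lebesgue (closure D) f"
    unfolding set_integrable_def
    by (subst integrable_completion) (simp_all add: borel_measurable_integrable)
  then have "set_integrable lebesgue D f"
    by (rule set_integrable_subset) (use assms closure_subset in auto)
  then show ?thesis
    using assms by (simp add: integrable_restrict_space set_integrable_def)
qed

lemma L2_on_of_continuous_closure:
  assumes "open D" "bounded D" "continuous_on (closure D) f"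
  shows "L2_on D f"
  unfolding L2_on_def
  using integrable_lebesgue_on_of_continuous_closure[OF assms]
  by (auto intro!: integrable_lebesgue_on_of_continuous_closure continuous_intros assms)

text \<open>A nonnegative function with nonpositive integral vanishes almost everywhere. By
  continuity the set where it does not vanish is open, and an open null set is empty.\<close>

lemma continuous_nonneg_integral_eq_0:
  fixes f :: "'a::euclidean_space \<Rightarrow> real"
  assumes "open D" "continuous_on D f" "integrable (lebesgue_on D) f"
    and "\<And>x. x \<in> D \<Longrightarrow> 0 \<le> f x" "(LINT x|lebesgue_on D. f x) \<le> 0" "x \<in> D"
  shows "f x = 0"
proof (rule ccontr)
  assume "f x \<noteq> 0"
  define U where "U = D \<inter> f -` (- {0})"
  have nonneg: "AE x in lebesgue_on D. 0 \<le> f x"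
    using assms by (intro AE_I2) auto
  then have "0 \<le> (LINT x|lebesgue_on D. f x)"
    by (rule integral_nonneg_AE)
  then have "AE x in lebesgue_on D. f x = 0"
    using integral_nonneg_eq_0_iff_AE[OF assms(3) nonneg] assms(5) by simp
  then have "AE x in lebesgue. x \<in> D \<longrightarrow> f x = 0"
    using assms(1) by (simp add: AE_restrict_space_iff)
  \<comment> \<open>The exceptional set is only known to lie in a null set; completeness of
    \<open>lebesgue\<close> makes it a null set itself.\<close>
  then have "{x. \<not> (x \<in> D \<longrightarrow> f x = 0)} \<in> null_sets lebesgue"
    using AE_iff_null_sets assms by (simp only: eventually_ae_filter) (auto intro: null_sets_completion_subset)
  moreover have "{x. \<not> (x \<in> D \<longrightarrow> f x = 0)} = U"
    by (auto simp: U_def)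
  ultimately have "negligible U"
    by (simp add: negligible_iff_null_sets)
  moreover have "open U"
    unfolding U_def using assms by (intro continuous_open_preimage) auto
  moreover have "x \<in> U"
    using \<open>f x \<noteq> 0\<close> assms by (auto simp: U_def)
  ultimately show False
    using open_not_negligible by blast
qed

section \<open>From integral inequalities to pointwise conditions\<close>

lemma continuous_pos_ball:
  fixes f :: "'a::metric_space \<Rightarrow> real"
  assumes "open D" "continuous_on D f" "x \<in> D" "c < f x"
  shows "\<exists>r>0. cball x r \<subseteq> D \<and> (\<forall>y\<in>ball x r. c < f y)"
proof -
  have "open (D \<inter> f -` {c<..})"
    using assms by (intro continuous_open_preimage) auto
  then obtain r where "0 < r" "cball x r \<subseteq> D \<inter> f -` {c<..}"
    using assms(3,4) unfolding open_contains_cball by blast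
  moreover from this have "ball x r \<subseteq> f -` {c<..}"
    using ball_subset_cball[of x r] by blast
  ultimately show ?thesis
    by (intro exI[of _ r]) auto
qed

text \<open>If \<open>G\<close> were negative at \<open>x\<close>, it would be so on a ball. A bump
  on that ball makes \<open>- G * bump\<close> nonnegative with nonpositive integral, hence zero at
  \<open>x\<close>, where the bump is positive.\<close>

lemma nonneg_of_bump_integrals:
  fixes G :: "'a::euclidean_space \<Rightarrow> real"
  assumes "open D" "bounded D" "continuous_on (closure D) G" "x \<in> D"
    and "\<And>r. 0 < r \<Longrightarrow> cball x r \<subseteq> D \<Longrightarrow> 0 \<le> (LINT y|lebesgue_on D. G y * bump x r y)"
  shows "0 \<le> G x"
proof (rule ccontr)
  assume "\<not> 0 \<le> G x"
  have cont: "continuous_on D G"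
    using assms(3) closure_subset by (rule continuous_on_subset)
  have "0 < - G x"
    using \<open>\<not> 0 \<le> G x\<close> by simp
  from continuous_pos_ball[OF assms(1) continuous_on_minus[OF cont] assms(4) this]
  obtain r where r: "0 < r" "cball x r \<subseteq> D" "\<And>y. y \<in> ball x r \<Longrightarrow> 0 < - G y"
    by blast
  have "- (G x * bump x r x) = 0"
  proof (rule continuous_nonneg_integral_eq_0[OF assms(1), where f="\<lambda>y. - (G y * bump x r y)"])
    show "continuous_on D (\<lambda>y. - (G y * bump x r y))"
      by (intro continuous_intros cont)
    show "integrable (lebesgue_on D) (\<lambda>y. - (G y * bump x r y))"
      by (intro integrable_lebesgue_on_of_continuous_closure continuous_intros assms)
    show "0 \<le> - (G y * bump x r y)" for y
    proof (cases "y \<in> ball x r")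
      case True
      then show ?thesis
        using mult_nonneg_nonneg[OF less_imp_le[OF r(3)] bump_nonneg[of x r y]] by simp
    next
      case False
      then show ?thesis
        using bump_eq_0[OF False r(1)] by simp
    qed
    show "(LINT y|lebesgue_on D. - (G y * bump x r y)) \<le> 0"
      using assms(5)[OF r(1,2)] by simp
  qed fact
  then show False
    using bump_center[OF r(1), of x] \<open>\<not> 0 \<le> G x\<close> by simp
qed

text \<open>The test functions are \<open>v + c * bump\<close>. Positive \<open>c\<close> is always
  admissible and gives \<open>0 \<le> G\<close>; negative \<open>c\<close> is admissible for a small
  bump where the constraint is absent (\<open>0 < u x\<close>) or slack (\<open>0 < v x\<close>),
  and forces equality.\<close>

lemma residual_of_Y_inequality:
  assumes D: "open D" "bounded D"
    and cont: "continuous_on (closure D) G" "continuous_on (closure D) u" "continuous_on (closure D) v"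
    and v: "\<And>x. x \<in> coincidence_set D u \<Longrightarrow> 0 \<le> v x"
    and ineq: "\<And>w. w \<in> Y_set D u \<Longrightarrow> continuous_on (closure D) w \<Longrightarrow>
                 0 \<le> (LINT x|lebesgue_on D. G x * (w x - v x))"
    and x: "x \<in> D"
  shows "0 \<le> G x" and "0 < u x \<or> 0 < v x \<Longrightarrow> G x = 0"
proof -
  have contD: "continuous_on D G" "continuous_on D u" "continuous_on D v"
    by (rule continuous_on_subset[OF _ closure_subset], fact cont)+
  have test: "0 \<le> (LINT y|lebesgue_on D. G y * (c * bump a r y))"
    if "\<And>y. y \<in> coincidence_set D u \<Longrightarrow> 0 \<le> v y + c * bump a r y" for c a r
  proof -
    have "(\<lambda>y. v y + c * bump a r y) \<in> Y_set D u"
      unfolding Y_set_def mem_Collect_eq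
    proof
      show "L2_on D (\<lambda>y. v y + c * bump a r y)"
        by (intro L2_on_of_continuous_closure continuous_intros D cont)
      show "AE y in lebesgue_on D. y \<in> coincidence_set D u \<longrightarrow> 0 \<le> v y + c * bump a r y"
        using that by (intro AE_I2) blast
    qed
    moreover have "continuous_on (closure D) (\<lambda>y. v y + c * bump a r y)"
      by (intro continuous_intros cont)
    ultimately show ?thesis
      using ineq[of "\<lambda>y. v y + c * bump a r y"] by simp
  qed
  have nonneg: "0 \<le> G x" if "x \<in> D" for x
  proof (rule nonneg_of_bump_integrals[OF D cont(1) that])
    fix r
    show "0 \<le> (LINT y|lebesgue_on D. G y * bump x r y)"
      using test[of 1 x r] by (simp add: v bump_nonneg add_nonneg_nonneg)
  qed
  show "0 \<le> G x"
    using nonneg x .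
  show "G x = 0" if pos: "0 < u x \<or> 0 < v x"
  proof -
    obtain r c where r: "0 < r" "0 < c"
        "\<And>y. y \<in> coincidence_set D u \<Longrightarrow> 0 \<le> v y + - c * bump x r y"
      using pos
    proof
      assume "0 < u x"
      from continuous_pos_ball[OF D(1) contD(2) x this]
      obtain r where r: "0 < r" "\<And>y. y \<in> ball x r \<Longrightarrow> 0 < u y"
        by blast
      \<comment> \<open>The ball misses the coincidence set, so the constraint does not see the
        perturbation and amplitude 1 is admissible.\<close>
      have "0 \<le> v y + - 1 * bump x r y" if "y \<in> coincidence_set D u" for y
      proof -
        have "y \<notin> ball x r"
          using r(2)[of y] that by (auto simp: coincidence_set_def)
        then show ?thesis
          using v[OF that] bump_eq_0[of y x r] r(1) by simp
      qed
      then show thesis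
        by (rule that[OF r(1) zero_less_one])
    next
      assume vx: "0 < v x"
      then have "v x / 2 < v x"
        by simp
      from continuous_pos_ball[OF D(1) contD(3) x this]
      obtain r where r: "0 < r" "\<And>y. y \<in> ball x r \<Longrightarrow> v x / 2 < v y"
        by blast
      \<comment> \<open>The bump is at most \<open>r ^ 4\<close>, so this amplitude removes at most
        \<open>v x / 2\<close>, and \<open>v\<close> exceeds that value on the ball.\<close>
      define c where "c = v x / 2 / r ^ 4"
      have c: "0 < c" "c * r ^ 4 = v x / 2"
        using vx r(1) by (auto simp: c_def)
      have "0 \<le> v y + - c * bump x r y" if "y \<in> coincidence_set D u" for y
      proof (cases "y \<in> ball x r")
        case True
        have "c * bump x r y \<le> v x / 2"
          using mult_left_mono[OF bump_le[of r x y], of c] c r(1) by simp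
        then show ?thesis
          using r(2)[OF True] by simp
      next
        case False
        then show ?thesis
          using v[OF that] bump_eq_0[of y x r] r(1) by simp
      qed
      then show thesis
        by (rule that[OF r(1) c(1)])
    qed
    have "G x * (c * bump x r x) = 0"
    proof (rule continuous_nonneg_integral_eq_0[OF D(1), where f="\<lambda>y. G y * (c * bump x r y)"])
      show "continuous_on D (\<lambda>y. G y * (c * bump x r y))"
        by (intro continuous_intros contD)
      show "integrable (lebesgue_on D) (\<lambda>y. G y * (c * bump x r y))"
        by (intro integrable_lebesgue_on_of_continuous_closure continuous_intros D cont)
      show "0 \<le> G y * (c * bump x r y)" if "y \<in> D" for y
        using nonneg[OF that] r(2) bump_nonneg[of x r y] by simp
      show "(LINT y|lebesgue_on D. G y * (c * bump x r y)) \<le> 0"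
        using test[of "- c" x r, OF r(3)] by simp
    qed fact
    then show ?thesis
      using bump_center[OF r(1), of x] r(2) by simp
  qed
qed

text \<open>The set \<open>K\<close> is a cone: large multiples of a bump force
  \<open>0 \<le> G\<close>, and its vertex 0 shows that \<open>G * u\<close> has nonpositive
  integral. Being nonnegative, \<open>G * u\<close> then vanishes.\<close>

lemma residual_of_K_inequality:
  assumes D: "open D" "bounded D"
    and cont: "continuous_on (closure D) G" "continuous_on (closure D) u"
    and u: "\<And>x. x \<in> D \<Longrightarrow> 0 \<le> u x"
    and ineq: "\<And>w. w \<in> K_set D \<Longrightarrow> continuous_on (closure D) w \<Longrightarrow>
                 0 \<le> (LINT x|lebesgue_on D. G x * (w x - u x))"
    and x: "x \<in> D"
  shows "0 \<le> G x" and "0 < u x \<Longrightarrow> G x = 0"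
proof -
  have contD: "continuous_on D G" "continuous_on D u"
    by (rule continuous_on_subset[OF _ closure_subset], fact cont)+
  define J where "J = (LINT y|lebesgue_on D. G y * u y)"
  have int: "integrable (lebesgue_on D) (\<lambda>y. G y * u y)"
    by (intro integrable_lebesgue_on_of_continuous_closure continuous_intros D cont)
  have test: "0 \<le> c * (LINT y|lebesgue_on D. G y * bump a r y) - J"
    if "0 < r" "cball a r \<subseteq> D" "0 \<le> c" for a r c
  proof -
    have int': "integrable (lebesgue_on D) (\<lambda>y. G y * bump a r y)"
      by (intro integrable_lebesgue_on_of_continuous_closure continuous_intros D cont)
    have "0 \<le> (LINT y|lebesgue_on D. G y * (c * bump a r y - u y))"
      by (intro ineq bump_in_K_set that D continuous_intros)
    also have "\<dots> = (LINT y|lebesgue_on D. c * (G y * bump a r y) - G y * u y)"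
      by (simp add: algebra_simps)
    also have "\<dots> = c * (LINT y|lebesgue_on D. G y * bump a r y) - J"
      unfolding J_def using int int' by simp
    finally show ?thesis .
  qed
  obtain r0 where r0: "0 < r0" "cball x r0 \<subseteq> D"
    using D(1) x open_contains_cball by blast
  have J: "J \<le> 0"
    using test[OF r0, of 0] by simp
  have nonneg: "0 \<le> G y" if "y \<in> D" for y
  proof (rule nonneg_of_bump_integrals[OF D cont(1) that], rule ccontr)
    fix r assume r: "0 < r" "cball y r \<subseteq> D"
      and neg: "\<not> 0 \<le> (LINT z|lebesgue_on D. G z * bump y r z)" (is "\<not> 0 \<le> ?I")
    \<comment> \<open>With this multiple of the bump the tested expression equals -1, contradicting
      \<open>test\<close>; \<open>J \<le> 0\<close> keeps the multiple nonnegative.\<close>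
    have "0 \<le> (1 - J) / - ?I"
      using neg J by (intro divide_nonneg_nonneg) auto
    from test[OF r this] have "0 \<le> (1 - J) / - ?I * ?I - J" .
    moreover have "(1 - J) / - ?I * ?I = J - 1"
      using neg by (simp add: divide_simps)
    ultimately show False
      by linarith
  qed
  show "0 \<le> G x"
    using nonneg x .
  assume "0 < u x"
  moreover have "G x * u x = 0"
  proof (rule continuous_nonneg_integral_eq_0[OF D(1) _ int])
    show "continuous_on D (\<lambda>y. G y * u y)"
      by (intro continuous_intros contD)
    show "0 \<le> G y * u y" if "y \<in> D" for y
      using nonneg u that by simp
    show "(LINT y|lebesgue_on D. G y * u y) \<le> 0"
      using J by (simp add: J_def)
  qed fact
  ultimately show "G x = 0"
    by simp
qed

section \<open>Space-time derivatives and the residual\<close>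

text \<open>The map selected by \<open>frechet_derivative\<close> is linear, hence determined by its
  values on the basis, which are the components of \<open>grad\<close>. This covers boundary points
  as well.\<close>

lemma has_derivative_grad:
  assumes "f differentiable (at z within S)"
  shows "(f has_derivative (\<lambda>h. grad S f z \<bullet> h)) (at z within S)"
proof -
  let ?L = "frechet_derivative f (at z within S)"
  have L: "(f has_derivative ?L) (at z within S)"
    using assms by (simp add: frechet_derivative_works)
  then have "linear ?L"
    by (rule has_derivative_linear)
  have "?L h = grad S f z \<bullet> h" for h
  proof -
    have "?L h = ?L (\<Sum>b\<in>Basis. (h \<bullet> b) *\<^sub>R b)"
      by (simp add: euclidean_representation)
    also have "\<dots> = (\<Sum>b\<in>Basis. (h \<bullet> b) * ?L b)"
      using \<open>linear ?L\<close> by (simp add: linear_sum linear_cmul)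
    also have "\<dots> = grad S f z \<bullet> h"
      by (simp add: grad_def inner_sum_left inner_commute[of h] mult.commute)
    finally show ?thesis .
  qed
  then show ?thesis
    by (intro has_derivative_eq_rhs[OF L]) (rule ext)
qed

lemma C1_on_imp_continuous_on: "C1_on S f \<Longrightarrow> continuous_on S f"
  by (intro differentiable_imp_continuous_on) (simp add: C1_on_def differentiable_on_def)

text \<open>Quotient rule for \<open>q / A\<close>, followed by the trace over the basis. For
  \<open>q\<close> the gradient of \<open>u\<close> this is the mean curvature term, written with
  the second derivatives of \<open>u\<close>.\<close>

lemma divergence_normalized:
  fixes q :: "'a::euclidean_space \<Rightarrow> 'a"
  assumes "q differentiable (at x within S)" "x \<in> interior S"
  defines "q' \<equiv> frechet_derivative q (at x within S)"
    and "A \<equiv> sqrt (1 + (norm (q x))\<^sup>2)"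
  shows "divergence S (\<lambda>y. q y /\<^sub>R sqrt (1 + (norm (q y))\<^sup>2)) x
         = (\<Sum>b\<in>Basis. (q' b \<bullet> b) / A - (q x \<bullet> b) * (q x \<bullet> q' b) / A ^ 3)"
proof -
  have at: "at x within S = at x"
    using assms(2) by (rule at_within_interior)
  have q': "(q has_derivative q') (at x)"
    using assms(1) unfolding q'_def at by (simp add: frechet_derivative_works)
  have "0 < 1 + q x \<bullet> q x"
    using inner_ge_zero[of "q x"] by linarith
  have A: "sqrt (1 + q x \<bullet> q x) = A" "0 < A"
    using \<open>0 < 1 + q x \<bullet> q x\<close> by (simp_all add: A_def power2_norm_eq_inner)
  \<comment> \<open>Written with \<open>q y \<bullet> q y\<close> the root is differentiable also
    where \<open>q\<close> vanishes, unlike the norm.\<close>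
  have root: "((\<lambda>y. sqrt (1 + q y \<bullet> q y)) has_derivative (\<lambda>h. (q x \<bullet> q' h) / A)) (at x)"
    using has_derivative_real_sqrt[of "\<lambda>y. 1 + q y \<bullet> q y" x, OF \<open>0 < 1 + q x \<bullet> q x\<close>
        has_derivative_add[OF has_derivative_const has_derivative_inner[OF q' q']]]
    by (rule has_derivative_eq_rhs) (simp add: fun_eq_iff A inner_commute field_simps)
  have "((\<lambda>y. q y /\<^sub>R sqrt (1 + q y \<bullet> q y)) has_derivative
          (\<lambda>h. q' h /\<^sub>R A - ((q x \<bullet> q' h) / A ^ 3) *\<^sub>R q x)) (at x)"
    by (rule has_derivative_eq_rhs, rule has_derivative_scaleR[OF Deriv.has_derivative_inverse[OF _ root] q'])
      (use A in \<open>auto simp: fun_eq_iff power3_eq_cube divide_simps\<close>)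
  then have "frechet_derivative (\<lambda>y. q y /\<^sub>R sqrt (1 + q y \<bullet> q y)) (at x)
      = (\<lambda>h. q' h /\<^sub>R A - ((q x \<bullet> q' h) / A ^ 3) *\<^sub>R q x)"
    by (rule frechet_derivative_at[symmetric])
  then show ?thesis
    unfolding divergence_def at power2_norm_eq_inner
    by (simp add: inner_diff_left field_simps)
qed

text \<open>The spatial part of the space-time gradient is jointly continuous by assumption, whereas
  \<open>grad (closure (D t)) (u t)\<close> is formed separately at each time.\<close>

definition slope :: "real \<Rightarrow> (real \<Rightarrow> plane set) \<Rightarrow> (real \<Rightarrow> plane \<Rightarrow> real) \<Rightarrow> real \<Rightarrow> plane \<Rightarrow> plane" where
  "slope T D u t x = snd (grad (spacetime T D) (\<lambda>(s, y). u s y) (t, x))"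

text \<open>
  The residual \<open>\<zeta> \<partial>\<^sub>t u / \<surd>(1 + |\<nabla>u|\<^sup>2) - F\<close> up to the multiplier \<open>\<lambda>(t)\<close>, with the mean curvature
  written out and \<open>\<nabla>u\<close> read off the space-time gradient: in this form it is jointly continuous.
\<close>

definition residual where
  "residual \<gamma>LG \<rho> g \<zeta> T D u t x =
     (let p = slope T D u t x; A = sqrt (1 + (norm p)\<^sup>2);
          H = frechet_derivative (grad (closure (D t)) (u t)) (at x within closure (D t)) in
      \<zeta> * (time_deriv T D u t x / A) + \<rho> * g * u t x
      - \<gamma>LG * (\<Sum>b\<in>Basis. (H b \<bullet> b) / A - (p \<bullet> b) * (p \<bullet> H b) / A ^ 3))"

lemma continuous_on_residual:
  assumes "smooth_evolution T D u"
  shows "continuous_on (spacetime T D) (\<lambda>(t, x). residual \<gamma>LG \<rho> g \<zeta> T D u t x)"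
proof -
  have C1: "C1_on (spacetime T D) (\<lambda>(t, x). u t x)"
    and H: "\<And>b. b \<in> Basis \<Longrightarrow> continuous_on (spacetime T D)
      (\<lambda>z. frechet_derivative (grad (closure (D (fst z))) (u (fst z))) (at (snd z) within closure (D (fst z))) b)"
    using assms by (auto simp: smooth_evolution_def case_prod_unfold)
  have u: "continuous_on (spacetime T D) (\<lambda>z. u (fst z) (snd z))"
    using C1_on_imp_continuous_on[OF C1] by (simp add: case_prod_unfold)
  have grad: "continuous_on (spacetime T D) (grad (spacetime T D) (\<lambda>(t, x). u t x))"
    using C1 by (simp add: C1_on_def)
  have p: "continuous_on (spacetime T D) (\<lambda>z. slope T D u (fst z) (snd z))"
    and v: "continuous_on (spacetime T D) (\<lambda>z. time_deriv T D u (fst z) (snd z))"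
    using continuous_on_snd[OF grad] continuous_on_fst[OF grad]
    by (simp_all add: slope_def time_deriv_def)
  have "sqrt (1 + (norm p)\<^sup>2) \<noteq> 0" for p :: plane
    by (simp add: add_nonneg_eq_0_iff)
  then show ?thesis
    unfolding residual_def Let_def case_prod_unfold
    by (intro continuous_intros u p v H) simp_all
qed

lemma continuous_on_slice:
  assumes "continuous_on (spacetime T D) (\<lambda>(t, x). f t x)" "t \<in> {0..T}"
  shows "continuous_on (closure (D t)) (f t)"
proof -
  have "Pair t ` closure (D t) \<subseteq> spacetime T D"
    using assms(2) by (auto simp: spacetime_def)
  then have "continuous_on (closure (D t)) (\<lambda>x. case (t, x) of (t, x) \<Rightarrow> f t x)"
    by (rule continuous_on_compose2[OF assms(1), rotated])
      (intro continuous_on_Pair continuous_on_id continuous_on_const)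
  then show ?thesis
    by simp
qed

lemma has_derivative_spacetime:
  assumes "smooth_evolution T D u" "t \<in> {0..T}" "x \<in> closure (D t)"
  shows "((\<lambda>(s, y). u s y) has_derivative
            (\<lambda>h. time_deriv T D u t x * fst h + slope T D u t x \<bullet> snd h)) (at (t, x) within spacetime T D)"
proof -
  have "(\<lambda>(s, y). u s y) differentiable (at (t, x) within spacetime T D)"
    using assms by (auto simp: smooth_evolution_def C1_on_def spacetime_def)
  from has_derivative_grad[OF this] show ?thesis
    by (simp add: inner_prod_def slope_def time_deriv_def)
qed

text \<open>Chain rule along \<open>Pair t\<close>; at an interior point the derivative within the
  closure is the full one, so it is unique.\<close>

lemma slope_eq_grad:
  assumes "smooth_evolution T D u" "t \<in> {0..T}" "open (D t)" "x \<in> D t"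
  shows "grad (closure (D t)) (u t) x = slope T D u t x"
proof (rule grad_eqI)
  have x: "x \<in> closure (D t)"
    using closure_subset assms(4) by (rule subsetD)
  show int: "x \<in> interior (closure (D t))"
    using interior_maximal[OF closure_subset assms(3)] assms(4) by (rule subsetD)
  have emb: "(Pair t has_derivative (\<lambda>h. (0, h))) (at x within closure (D t))"
    by (intro has_derivative_Pair has_derivative_const has_derivative_ident)
  have "((\<lambda>(s, y). u s y) has_derivative
            (\<lambda>h. time_deriv T D u t x * fst h + slope T D u t x \<bullet> snd h)) (at (t, x) within Pair t ` closure (D t))"
    by (rule has_derivative_subset[OF has_derivative_spacetime[OF assms(1,2) x]])
      (use assms(2) in \<open>auto simp: spacetime_def\<close>)
  from has_derivative_in_compose[OF emb this]
  have "(u t has_derivative (\<lambda>h. slope T D u t x \<bullet> h)) (at x within closure (D t))"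
    by simp
  then show "(u t has_derivative (\<lambda>h. slope T D u t x \<bullet> h)) (at x)"
    by (simp only: at_within_interior[OF int])
qed

text \<open>By \<open>divergence_normalized\<close>, the expanded curvature in
  \<open>residual\<close> is the divergence in \<open>bulk_force\<close> at points of
  \<open>D t\<close>. Thus continuity of \<open>residual\<close> carries over to the defect of the
  evolution equation, apart from \<open>lam\<close>.\<close>

lemma residual_eq:
  assumes "smooth_evolution T D u" "t \<in> {0..T}" "open (D t)" "x \<in> D t"
  shows "residual \<gamma>LG \<rho> g \<zeta> T D u t x - lam
    = \<zeta> * (time_deriv T D u t x / area_factor (D t) (u t) x) - bulk_force \<rho> g \<gamma>LG lam (D t) (u t) x"
proof -
  have x: "x \<in> closure (D t)" "x \<in> interior (closure (D t))"
    using subsetD[OF closure_subset assms(4)] subsetD[OF interior_maximal[OF closure_subset assms(3)] assms(4)] .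
  have "grad (closure (D t)) (u t) differentiable (at x within closure (D t))"
    using assms x by (auto simp: smooth_evolution_def)
  from divergence_normalized[OF this x(2)] show ?thesis
    unfolding residual_def bulk_force_def area_factor_def Let_def slope_eq_grad[OF assms, symmetric]
    by (simp add: algebra_simps)
qed

section \<open>Behaviour in time at a fixed point\<close>

text \<open>The level set function is continuous in time and negative at \<open>(t, x)\<close>, so
  \<open>x\<close> stays in the domain for all times of the interval near \<open>t\<close>. Limits
  in time may therefore be taken inside \<open>spacetime\<close>.\<close>

lemma at_within_wet_times:
  assumes "smooth_contact_line T D" "t \<in> {0..T}" "x \<in> D t"
  shows "at t within {s \<in> {0..T}. x \<in> D s} = at t within {0..T}"
proof -
  obtain \<phi> where \<phi>: "C1_on ({0..T} \<times> UNIV) (\<lambda>(t, x). \<phi> t x)" "\<And>s. s \<in> {0..T} \<Longrightarrow> D s = {x. \<phi> s x < 0}"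
    using assms(1) by (auto simp: smooth_contact_line_def)
  have "continuous_on {0..T} (\<lambda>s. case (s, x) of (t, x) \<Rightarrow> \<phi> t x)"
    by (rule continuous_on_compose2[OF C1_on_imp_continuous_on[OF \<phi>(1)]],
        intro continuous_on_Pair continuous_on_id continuous_on_const) auto
  then have "((\<lambda>s. \<phi> s x) \<longlongrightarrow> \<phi> t x) (at t within {0..T})"
    using assms(2) by (simp add: continuous_on_def)
  then have "\<forall>\<^sub>F s in at t within {0..T}. \<phi> s x < 0"
    using assms(2,3) \<phi>(2) by (intro order_tendstoD(2)) auto
  then obtain S where S: "open S" "t \<in> S" "\<And>s. s \<in> S \<Longrightarrow> s \<noteq> t \<Longrightarrow> s \<in> {0..T} \<Longrightarrow> \<phi> s x < 0"
    unfolding eventually_at_topological by blast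
  have "x \<in> D s" if "s \<in> S" "s \<noteq> t" "s \<in> {0..T}" for s
    using S(3)[OF that] \<phi>(2)[OF that(3)] by simp
  then show ?thesis
    by (intro at_within_nhd[OF S(2,1)]) blast
qed

lemma tendsto_wet_times:
  assumes "smooth_contact_line T D" "t \<in> {0..T}" "x \<in> D t"
    and "continuous_on (spacetime T D) (\<lambda>(t, x). f t x)"
  shows "((\<lambda>s. f s x) \<longlongrightarrow> f t x) (at t within {0..T})"
proof -
  have "(\<lambda>s. (s, x)) ` {s \<in> {0..T}. x \<in> D s} \<subseteq> spacetime T D"
    by (auto simp: spacetime_def intro: subsetD[OF closure_subset])
  then have "continuous_on {s \<in> {0..T}. x \<in> D s} (\<lambda>s. case (s, x) of (t, x) \<Rightarrow> f t x)"
    by (rule continuous_on_compose2[OF assms(4), rotated])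
      (intro continuous_on_Pair continuous_on_id continuous_on_const)
  then have "((\<lambda>s. f s x) \<longlongrightarrow> f t x) (at t within {s \<in> {0..T}. x \<in> D s})"
    unfolding continuous_on_def prod.case using assms(2,3) by blast
  then show ?thesis
    by (simp only: at_within_wet_times[OF assms(1-3)])
qed

lemma eventually_wet:
  assumes "smooth_contact_line T D" "t \<in> {0..T}" "x \<in> D t"
  shows "\<forall>\<^sub>F s in at t within {0..T}. s \<in> {0..T} \<and> x \<in> D s"
  unfolding at_within_wet_times[OF assms, symmetric] eventually_at_filter by simp

text \<open>Chain rule along the vertical line \<open>s \<mapsto> (s, x)\<close>, which stays in
  \<open>spacetime\<close> at the wet times. It identifies \<open>time_deriv\<close> with the
  ordinary time derivative at fixed \<open>x\<close>.\<close>

lemma has_field_derivative_time: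
  assumes "smooth_evolution T D u" "t \<in> {0..T}" "x \<in> D t"
  shows "((\<lambda>s. u s x) has_field_derivative time_deriv T D u t x) (at t within {0..T})"
proof -
  let ?W = "{s \<in> {0..T}. x \<in> D s}"
  have x: "x \<in> closure (D t)"
    using closure_subset assms(3) by (rule subsetD)
  have emb: "((\<lambda>s. (s, x)) has_derivative (\<lambda>h. (h, 0))) (at t within ?W)"
    by (intro has_derivative_Pair has_derivative_const has_derivative_ident)
  have "(\<lambda>s. (s, x)) ` ?W \<subseteq> spacetime T D"
    by (auto simp: spacetime_def intro: subsetD[OF closure_subset])
  then have "((\<lambda>(s, y). u s y) has_derivative
      (\<lambda>h. time_deriv T D u t x * fst h + slope T D u t x \<bullet> snd h)) (at (t, x) within (\<lambda>s. (s, x)) ` ?W)"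
    by (rule has_derivative_subset[OF has_derivative_spacetime[OF assms(1,2) x]])
  from has_derivative_in_compose[OF emb this]
  have "((\<lambda>s. u s x) has_derivative (*) (time_deriv T D u t x)) (at t within ?W)"
    by simp
  moreover have "at t within ?W = at t within {0..T}"
    using assms by (intro at_within_wet_times) (simp_all add: smooth_evolution_def)
  ultimately show ?thesis
    by (simp add: has_field_derivative_def)
qed

text \<open>
  At a contact point with \<open>\<partial>\<^sub>t u \<noteq> 0\<close> the film is detached at all nearby times \<open>s \<noteq> t\<close>, where the
  residual is known to vanish. As \<open>\<lambda>\<close> need not be continuous, it is eliminated by comparison
  with a point \<open>y\<close> where \<open>u > 0\<close>.
\<close>

lemma residual_at_moving_contact_point:
  assumes smooth: "smooth_evolution T D u" and T: "0 < T" and t: "t \<in> {0..T}"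
    and nonneg: "\<And>s z. s \<in> {0..T} \<Longrightarrow> z \<in> D s \<Longrightarrow> 0 \<le> u s z"
    and free: "\<And>s z. s \<in> {0..T} \<Longrightarrow> z \<in> D s \<Longrightarrow> 0 < u s z \<Longrightarrow> residual \<gamma>LG \<rho> g \<zeta> T D u s z = lam s"
    and x: "x \<in> D t" "u t x = 0" "time_deriv T D u t x \<noteq> 0"
    and y: "y \<in> D t" "0 < u t y"
  shows "residual \<gamma>LG \<rho> g \<zeta> T D u t x = lam t"
proof -
  let ?F = "at t within {0..T}" and ?R = "residual \<gamma>LG \<rho> g \<zeta> T D u"
  have line: "smooth_contact_line T D" and C1: "C1_on (spacetime T D) (\<lambda>(t, x). u t x)"
    using smooth by (simp_all add: smooth_evolution_def)
  have "((\<lambda>s. (u s x - u t x) / (s - t)) \<longlongrightarrow> time_deriv T D u t x) ?F"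
    using has_field_derivative_time[OF smooth t x(1)] by (simp add: has_field_derivative_iff)
  \<comment> \<open>Since \<open>u t x = 0\<close>, a nonzero quotient means that
    \<open>u s x\<close> is nonzero, hence positive, so \<open>free\<close> applies at time
    \<open>s\<close>.\<close>
  then have "\<forall>\<^sub>F s in ?F. (u s x - u t x) / (s - t) \<noteq> 0"
    using x(3) by (rule tendsto_imp_eventually_ne)
  then have "\<forall>\<^sub>F s in ?F. ?R s x = lam s"
    using eventually_wet[OF line t x(1)]
  proof eventually_elim
    case (elim s)
    then show ?case
      using nonneg[of s x] free[of s x] x(2) by auto
  qed
  moreover have "\<forall>\<^sub>F s in ?F. 0 < u s y"
    using order_tendstoD(1)[OF tendsto_wet_times[OF line t y(1) C1_on_imp_continuous_on[OF C1]] y(2)] .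
  then have "\<forall>\<^sub>F s in ?F. ?R s y = lam s"
    using eventually_wet[OF line t y(1)] by eventually_elim (simp add: free)
  \<comment> \<open>Both residuals equal \<open>lam s\<close>, which cancels; the difference has a
    limit even if \<open>lam\<close> jumps at \<open>t\<close>.\<close>
  ultimately have "\<forall>\<^sub>F s in ?F. ?R s x - ?R s y = 0"
    by eventually_elim simp
  then have "((\<lambda>s. ?R s x - ?R s y) \<longlongrightarrow> 0) ?F"
    by (rule tendsto_eventually)
  moreover have "((\<lambda>s. ?R s x - ?R s y) \<longlongrightarrow> ?R t x - ?R t y) ?F"
    by (intro tendsto_diff tendsto_wet_times[OF line t x(1)] tendsto_wet_times[OF line t y(1)]
        continuous_on_residual smooth)
  \<comment> \<open>Uniqueness of limits requires a nontrivial filter: \<open>0 < T\<close> makes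
    \<open>t\<close> a limit point of the interval, also at its ends.\<close>
  moreover have "?F \<noteq> bot"
    using T t by (simp add: trivial_limit_within islimpt_Icc)
  ultimately have "?R t x - ?R t y = 0"
    using tendsto_unique by blast
  then show ?thesis
    using free[OF t y] by simp
qed

section \<open>The strong form from the two variational inequalities\<close>

lemma common_conditionsD:
  assumes "common_conditions \<gamma>LG \<theta>Y \<xi> V T D u vCL" "t \<in> {0..T}"
  shows "open (D t)" "bounded (D t)" "\<And>x. x \<in> D t \<Longrightarrow> 0 \<le> u t x"
    and "\<And>x. x \<in> coincidence_set (D t) (u t) \<Longrightarrow> 0 \<le> time_deriv T D u t x"
    and "(LINT x|lebesgue_on (D t). u t x) = V"
    and "continuous_on (closure (D t)) (time_deriv T D u t)"
  using assms by (auto simp: common_conditions_def config_manifold_def tangent_cone_def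
      intro: C1_on_imp_continuous_on)

text \<open>Off the coincidence set \<open>u > 0\<close> gives equality. On it, either
  \<open>?v > 0\<close>, which gives equality and excludes \<open>?F < 0\<close>, or
  \<open>?v = 0\<close>, and then the inequality yields \<open>?F \<le> 0\<close>, so that
  \<open>0 \<le> ?F\<close> leaves only \<open>?F = 0\<close>.\<close>

lemma strong_form_of_residual:
  assumes smooth: "smooth_evolution T D u"
    and common: "common_conditions \<gamma>LG \<theta>Y \<xi> V T D u vCL"
    and nonneg: "\<And>t x. t \<in> {0..T} \<Longrightarrow> x \<in> D t \<Longrightarrow> lam t \<le> residual \<gamma>LG \<rho> g \<zeta> T D u t x"
    and eq: "\<And>t x. t \<in> {0..T} \<Longrightarrow> x \<in> D t \<Longrightarrow> 0 < u t x \<or> 0 < time_deriv T D u t x \<Longrightarrow>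
               residual \<gamma>LG \<rho> g \<zeta> T D u t x = lam t"
    and "0 < \<zeta>"
  shows "strong_form \<gamma>LG \<theta>Y \<rho> g \<xi> \<zeta> V T D u vCL lam"
  unfolding strong_form_def Let_def
proof (intro conjI common ballI)
  fix t x assume t: "t \<in> {0..T}" and x: "x \<in> D t"
  note c = common_conditionsD[OF common t]
  let ?F = "bulk_force \<rho> g \<gamma>LG (lam t) (D t) (u t) x" and ?B = "coincidence_set (D t) (u t)"
    and ?v = "time_deriv T D u t x" and ?A = "area_factor (D t) (u t) x"
  note R = residual_eq[OF smooth t c(1) x, of \<gamma>LG \<rho> g \<zeta> "lam t"]
  have ge: "?F \<le> \<zeta> * (?v / ?A)"
    using nonneg[OF t x] R by simp
  have pos: "\<zeta> * (?v / ?A) = ?F" if "0 < u t x \<or> 0 < ?v"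
    using eq[OF t x that] R by simp
  have v: "0 < ?v \<or> ?v = 0" if "x \<in> ?B"
    using c(4)[OF that] by auto
  have "0 < ?A"
    by (simp add: area_factor_def add_pos_nonneg)
  show "x \<notin> ?B \<or> 0 \<le> ?F \<longrightarrow> \<zeta> * (?v / ?A) = ?F"
  proof (cases "x \<in> ?B")
    case True
    then show ?thesis
      using v pos ge by auto
  next
    case False
    then have "0 < u t x"
      using c(3)[OF x] x by (auto simp: coincidence_set_def)
    then show ?thesis
      using pos by simp
  qed
  show "x \<in> ?B \<and> ?F < 0 \<longrightarrow> ?v = 0"
  proof
    assume B: "x \<in> ?B \<and> ?F < 0"
    have "\<not> 0 < ?v"
      using B pos \<open>0 < ?A\<close> \<open>0 < \<zeta>\<close> by (metis divide_pos_pos less_asym mult_pos_pos)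
    then show "?v = 0"
      using B v by blast
  qed
qed

text \<open>The force is rewritten through the residual, so that both resulting integrands are
  continuous up to the boundary. They are then integrable, and the integral can be split.\<close>

lemma bulk_integral_inequality:
  assumes smooth: "smooth_evolution T D u" and t: "t \<in> {0..T}"
    and common: "common_conditions \<gamma>LG \<theta>Y \<xi> V T D u vCL"
    and f: "continuous_on (closure (D t)) f"
    and ineq: "(LINT x|lebesgue_on (D t). bulk_force \<rho> g \<gamma>LG lam (D t) (u t) x * f x)
      \<le> \<zeta> * (LINT x|lebesgue_on (D t). time_deriv T D u t x / area_factor (D t) (u t) x * f x)"
  shows "0 \<le> (LINT x|lebesgue_on (D t). (residual \<gamma>LG \<rho> g \<zeta> T D u t x - lam) * f x)"
proof -
  note c = common_conditionsD[OF common t]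
  let ?R = "residual \<gamma>LG \<rho> g \<zeta> T D u t" and ?M = "lebesgue_on (D t)"
    and ?F = "bulk_force \<rho> g \<gamma>LG lam (D t) (u t)"
  let ?q = "\<lambda>x. time_deriv T D u t x / sqrt (1 + (norm (grad (closure (D t)) (u t) x))\<^sup>2)"
  have R: "continuous_on (closure (D t)) ?R"
    using continuous_on_residual[OF smooth] t by (rule continuous_on_slice)
  have "grad (closure (D t)) (u t) differentiable_on closure (D t)"
    using smooth t by (simp add: smooth_evolution_def differentiable_on_def)
  then have grad: "continuous_on (closure (D t)) (grad (closure (D t)) (u t))"
    by (rule differentiable_imp_continuous_on)
  have "sqrt (1 + (norm p)\<^sup>2) \<noteq> 0" for p :: plane
    by (simp add: add_nonneg_eq_0_iff)
  then have q: "continuous_on (closure (D t)) ?q"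
    by (intro continuous_intros c(6) grad) simp
  have int: "integrable ?M (\<lambda>x. ?q x * f x)" "integrable ?M (\<lambda>x. (?R x - lam) * f x)"
    by (intro integrable_lebesgue_on_of_continuous_closure c continuous_on_mult q f
        continuous_on_diff R continuous_on_const)+
  have "(LINT x|?M. ?F x * f x) = (LINT x|?M. \<zeta> * (?q x * f x) - (?R x - lam) * f x)"
  proof (rule Bochner_Integration.integral_cong[OF refl])
    fix x assume "x \<in> space ?M"
    then have "x \<in> D t"
      by simp
    from residual_eq[OF smooth t c(1) this, of \<gamma>LG \<rho> g \<zeta> lam]
    have "?F x = \<zeta> * ?q x - (?R x - lam)"
      by (simp add: area_factor_def)
    then show "?F x * f x = \<zeta> * (?q x * f x) - (?R x - lam) * f x"
      by (simp only: left_diff_distrib mult.assoc)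
  qed
  also have "\<dots> = \<zeta> * (LINT x|?M. ?q x * f x) - (LINT x|?M. (?R x - lam) * f x)"
    by (simp only: Bochner_Integration.integral_diff[OF integrable_mult_right[OF int(1)] int(2)]
        Bochner_Integration.integral_mult_right_zero)
  finally show ?thesis
    using ineq by (simp add: area_factor_def)
qed

text \<open>Each time is treated separately: \<open>residual_of_Y_inequality\<close> applies with
  \<open>v\<close> the time derivative and already covers contact points with positive time
  derivative.\<close>

lemma strong_form_of_PVI1:
  assumes smooth: "smooth_evolution T D u" and "0 < \<zeta>" and PVI: "PVI1 \<gamma>LG \<theta>Y \<rho> g \<xi> \<zeta> V T D u vCL lam"
  shows "strong_form \<gamma>LG \<theta>Y \<rho> g \<xi> \<zeta> V T D u vCL lam"
proof -
  have common: "common_conditions \<gamma>LG \<theta>Y \<xi> V T D u vCL"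
    using PVI by (simp add: PVI1_def)
  have C1: "C1_on (spacetime T D) (\<lambda>(t, x). u t x)"
    using smooth by (simp add: smooth_evolution_def)
  have *: "lam t \<le> residual \<gamma>LG \<rho> g \<zeta> T D u t x \<and>
      (0 < u t x \<or> 0 < time_deriv T D u t x \<longrightarrow> residual \<gamma>LG \<rho> g \<zeta> T D u t x = lam t)"
    if t: "t \<in> {0..T}" and x: "x \<in> D t" for t x
  proof -
    note c = common_conditionsD[OF common t]
    let ?G = "\<lambda>x. residual \<gamma>LG \<rho> g \<zeta> T D u t x - lam t"
    have G: "continuous_on (closure (D t)) ?G"
      by (rule continuous_on_diff[OF continuous_on_slice[OF continuous_on_residual[OF smooth] t]
            continuous_on_const])
    have u: "continuous_on (closure (D t)) (u t)"
      using C1_on_imp_continuous_on[OF C1] t by (rule continuous_on_slice)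
    have ineq: "0 \<le> (LINT x|lebesgue_on (D t). ?G x * (w x - time_deriv T D u t x))"
      if w: "w \<in> Y_set (D t) (u t)" "continuous_on (closure (D t)) w" for w
    proof (rule bulk_integral_inequality[OF smooth t common])
      show "continuous_on (closure (D t)) (\<lambda>x. w x - time_deriv T D u t x)"
        using w(2) c(6) by (rule continuous_on_diff)
      show "(LINT x|lebesgue_on (D t). bulk_force \<rho> g \<gamma>LG (lam t) (D t) (u t) x * (w x - time_deriv T D u t x))
        \<le> \<zeta> * (LINT x|lebesgue_on (D t).
              time_deriv T D u t x / area_factor (D t) (u t) x * (w x - time_deriv T D u t x))"
        by (rule PVI[unfolded PVI1_def, THEN conjunct2, rule_format, OF t w(1)])
    qed
    note G_props = residual_of_Y_inequality[OF c(1,2) G u c(6) _ _ x]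
    have "0 \<le> ?G x"
      by (rule G_props(1), erule c(4), erule (1) ineq)
    moreover have "?G x = 0" if "0 < u t x \<or> 0 < time_deriv T D u t x"
      by (rule G_props(2)[OF _ _ that], erule c(4), erule (1) ineq)
    ultimately show ?thesis
      by simp
  qed
  show ?thesis
    by (rule strong_form_of_residual[OF smooth common _ _ \<open>0 < \<zeta>\<close>]) (simp_all add: *)
qed

text \<open>At a fixed time \<open>K\<close> yields equality only where \<open>u > 0\<close>;
  contact points with positive time derivative are reached by the limit in time.\<close>

lemma strong_form_of_PVI2:
  assumes smooth: "smooth_evolution T D u" and "0 < \<zeta>" "0 < V" "0 < T"
    and PVI: "PVI2 \<gamma>LG \<theta>Y \<rho> g \<xi> \<zeta> V T D u vCL lam"
  shows "strong_form \<gamma>LG \<theta>Y \<rho> g \<xi> \<zeta> V T D u vCL lam"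
proof -
  have common: "common_conditions \<gamma>LG \<theta>Y \<xi> V T D u vCL"
    using PVI by (simp add: PVI2_def)
  have C1: "C1_on (spacetime T D) (\<lambda>(t, x). u t x)"
    using smooth by (simp add: smooth_evolution_def)
  have *: "lam t \<le> residual \<gamma>LG \<rho> g \<zeta> T D u t x \<and>
      (0 < u t x \<longrightarrow> residual \<gamma>LG \<rho> g \<zeta> T D u t x = lam t)"
    if t: "t \<in> {0..T}" and x: "x \<in> D t" for t x
  proof -
    note c = common_conditionsD[OF common t]
    let ?G = "\<lambda>x. residual \<gamma>LG \<rho> g \<zeta> T D u t x - lam t"
    have G: "continuous_on (closure (D t)) ?G"
      by (rule continuous_on_diff[OF continuous_on_slice[OF continuous_on_residual[OF smooth] t]
            continuous_on_const])
    have u: "continuous_on (closure (D t)) (u t)"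
      using C1_on_imp_continuous_on[OF C1] t by (rule continuous_on_slice)
    have ineq: "0 \<le> (LINT x|lebesgue_on (D t). ?G x * (w x - u t x))"
      if w: "w \<in> K_set (D t)" "continuous_on (closure (D t)) w" for w
    proof (rule bulk_integral_inequality[OF smooth t common])
      show "continuous_on (closure (D t)) (\<lambda>x. w x - u t x)"
        using w(2) u by (rule continuous_on_diff)
      show "(LINT x|lebesgue_on (D t). bulk_force \<rho> g \<gamma>LG (lam t) (D t) (u t) x * (w x - u t x))
        \<le> \<zeta> * (LINT x|lebesgue_on (D t).
              time_deriv T D u t x / area_factor (D t) (u t) x * (w x - u t x))"
        by (rule PVI[unfolded PVI2_def, THEN conjunct2, rule_format, OF t w(1)])
    qed
    note G_props = residual_of_K_inequality[OF c(1,2) G u _ _ x]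
    have "0 \<le> ?G x"
      by (rule G_props(1), erule c(3), erule (1) ineq)
    moreover have "?G x = 0" if "0 < u t x"
      by (rule G_props(2)[OF _ _ that], erule c(3), erule (1) ineq)
    ultimately show ?thesis
      by simp
  qed
  have moving: "residual \<gamma>LG \<rho> g \<zeta> T D u t x = lam t"
    if t: "t \<in> {0..T}" and x: "x \<in> D t" and v: "0 < time_deriv T D u t x" for t x
  proof (cases "u t x = 0")
    case True
    \<comment> \<open>The comparison point that eliminates the multiplier exists because the volume
      \<open>V\<close> is positive.\<close>
    have "\<exists>y\<in>D t. 0 < u t y"
    proof (rule ccontr)
      assume "\<not> (\<exists>y\<in>D t. 0 < u t y)"
      then have "u t y = 0" if "y \<in> D t" for y
        using common_conditionsD(3)[OF common t that] that by force
      then have "(LINT y|lebesgue_on (D t). u t y) = (LINT y|lebesgue_on (D t). 0)"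
        by (intro Bochner_Integration.integral_cong) auto
      then show False
        using common_conditionsD(5)[OF common t] \<open>0 < V\<close> by simp
    qed
    then obtain y where y: "y \<in> D t" "0 < u t y"
      by blast
    show ?thesis
      by (rule residual_at_moving_contact_point[OF smooth \<open>0 < T\<close> t _ _ x True _ y])
        (use common_conditionsD(3)[OF common] * v in auto)
  next
    case False
    then have "0 < u t x"
      using common_conditionsD(3)[OF common t x] by simp
    then show ?thesis
      using * t x by blast
  qed
  show ?thesis
    by (rule strong_form_of_residual[OF smooth common _ _ \<open>0 < \<zeta>\<close>]) (use * moving in auto)
qed

theorem proposition2p1:
  fixes \<gamma>LG \<gamma>SL \<gamma>SG \<rho> g \<xi> \<zeta> V T \<theta>Y :: real
    and D :: "real \<Rightarrow> plane set"
    and u vCL :: "real \<Rightarrow> plane \<Rightarrow> real"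
    and lam :: "real \<Rightarrow> real"
  assumes "\<gamma>LG > 0" "\<gamma>SL > 0" "\<gamma>SG > 0" "\<rho> > 0" "g > 0" "\<xi> > 0" "\<zeta> > 0" "V > 0" "T > 0"
    and "cos \<theta>Y = (\<gamma>SG - \<gamma>SL) / \<gamma>LG" and "0 < cos \<theta>Y" "cos \<theta>Y < 1"
    and "contact_line_speed T D u vCL"
    and "smooth_evolution T D u"
  shows "(PVI1 \<gamma>LG \<theta>Y \<rho> g \<xi> \<zeta> V T D u vCL lam \<longrightarrow> strong_form \<gamma>LG \<theta>Y \<rho> g \<xi> \<zeta> V T D u vCL lam) \<and>
         (PVI2 \<gamma>LG \<theta>Y \<rho> g \<xi> \<zeta> V T D u vCL lam \<longrightarrow> strong_form \<gamma>LG \<theta>Y \<rho> g \<xi> \<zeta> V T D u vCL lam)"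
  using strong_form_of_PVI1[OF assms(14,7)] strong_form_of_PVI2[OF assms(14,7,8,9)] by simp

end
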